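(* $\operatorname{Cov}(\mathrm{Cont}(\omega^\omega))=\operatorname{Cov}(\mathrm{Cont}(\mathbb R))=\operatorname{Cov}(\mathrm{Cont}(2^\omega))$.
   Context: For a topological space $X$, $\mathrm{Cont}(X)$ is the $\sigma$-ideal on $X\times X$ generated by the graphs of continuous functions $f:X\to X$ and their reflections $\{(y,x):f(x)=y\}$; $\operatorname{Cov}(\mathrm{Cont}(X))$ is the least number of sets in $\mathrm{Cont}(X)$ needed to cover $X\times X$. $\omega^\omega$ and $2^\omega$ carry the product topology and $\mathbb R$ the usual topology. *)

theory Defs
  imports "HOL-Analysis.Analysis"
begin

unbundle cardinal_syntax

definition sigma_ideal :: "'a set set \<Rightarrow> bool" where
  "sigma_ideal I \<longleftrightarrow>
     {} \<in> I \<and>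
     (\<forall>A\<in>I. \<forall>B. B \<subseteq> A \<longrightarrow> B \<in> I) \<and>
     (\<forall>\<A>. countable \<A> \<and> \<A> \<subseteq> I \<longrightarrow> \<Union>\<A> \<in> I)"

definition Cont :: "'a::topological_space itself \<Rightarrow> ('a \<times> 'a) set set" where
  "Cont _ = sigma_ideal hull
     ({{(x, y). f x = y} | f :: 'a \<Rightarrow> 'a. continuous_on UNIV f} \<union>
      {{(y, x). f x = y} | f :: 'a \<Rightarrow> 'a. continuous_on UNIV f})"

definition covering_family :: "'a set set \<Rightarrow> 'a set set \<Rightarrow> bool" where
  "covering_family I \<F> \<longleftrightarrow> \<F> \<subseteq> I \<and> \<Union>\<F> = UNIV"

text \<open>The least cardinality of a subfamily of \<^term>\<open>I\<close> covering the whole space. A cardinal is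
  represented by a cardinal well-order on a type that depends on the space, so cardinals belonging
  to different spaces are compared by \<open>=o\<close>. The choice only picks a witness of least size; when
  \<^term>\<open>I\<close> covers the space at all, one exists (\<open>Cov_least\<close> below).\<close>

definition Cov :: "'a set set \<Rightarrow> 'a set rel" where
  "Cov I = |SOME \<F>. covering_family I \<F> \<and> (\<forall>\<G>. covering_family I \<G> \<longrightarrow> |\<F>| \<le>o |\<G>| )|"

lemma Cov_least:
  assumes "\<Union>I = UNIV"
  shows "\<exists>\<F>. covering_family I \<F> \<and> Cov I = |\<F>|"
    and "covering_family I \<G> \<Longrightarrow> Cov I \<le>o |\<G>|"
proof -
  let ?P = "\<lambda>\<F>. covering_family I \<F> \<and> (\<forall>\<G>. covering_family I \<G> \<longrightarrow> |\<F>| \<le>o |\<G>| )"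
  have "covering_family I I"
    using assms by (simp add: covering_family_def)
  then have "card_of ` {\<F>. covering_family I \<F>} \<noteq> {}"
    by blast
  then have "\<exists>r\<in>card_of ` {\<F>. covering_family I \<F>}.
      \<forall>r'\<in>card_of ` {\<F>. covering_family I \<F>}. r \<le>o r'"
    by (rule exists_minim_Card_order) (auto intro: card_of_Card_order)
  then have "\<exists>\<F>. ?P \<F>"
    by blast
  then have *: "?P (SOME \<F>. ?P \<F>)"
    by (rule someI_ex)
  show "\<exists>\<F>. covering_family I \<F> \<and> Cov I = |\<F>|"
    using * unfolding Cov_def by blast
  show "covering_family I \<G> \<Longrightarrow> Cov I \<le>o |\<G>|"
    using * unfolding Cov_def by blast
qed

lemma sigma_ideal_Cont: "sigma_ideal (Cont TYPE('a::topological_space))"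
  unfolding Cont_def
proof (rule hull_in)
  fix T :: "('a \<times> 'a) set set set"
  assume "\<forall>I\<in>T. sigma_ideal I"
  then have T: "\<And>I. I \<in> T \<Longrightarrow> sigma_ideal I" by blast
  show "sigma_ideal (\<Inter>T)"
    unfolding sigma_ideal_def
  proof (intro conjI ballI allI impI)
    show "{} \<in> \<Inter>T" using T by (auto simp: sigma_ideal_def)
    show "B \<in> \<Inter>T" if "A \<in> \<Inter>T" "B \<subseteq> A" for A B
    proof
      fix I assume "I \<in> T"
      with that T[OF this] show "B \<in> I" unfolding sigma_ideal_def by blast
    qed
    show "\<Union>\<A> \<in> \<Inter>T" if "countable \<A> \<and> \<A> \<subseteq> \<Inter>T" for \<A>
    proof
      fix I assume "I \<in> T"
      with that have "countable \<A> \<and> \<A> \<subseteq> I" by blast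
      with T[OF \<open>I \<in> T\<close>] show "\<Union>\<A> \<in> I" unfolding sigma_ideal_def by blast
    qed
  qed
qed

lemma Union_Cont: "\<Union>(Cont TYPE('a::topological_space)) = UNIV"
proof -
  have "p \<in> \<Union>(Cont TYPE('a))" for p :: "'a \<times> 'a"
  proof
    have "\<exists>f. {(x, y). (\<lambda>_. snd p) x = y} = {(x :: 'a, y). f x = y} \<and> continuous_on UNIV f"
      by (rule exI[of _ "\<lambda>_. snd p"]) simp
    then show "{(x, y). (\<lambda>_. snd p) x = y} \<in> Cont TYPE('a)"
      unfolding Cont_def by (intro hull_inc UnI1) blast
    show "p \<in> {(x, y). (\<lambda>_. snd p) x = y}" by (auto split: prod.split)
  qed
  then show ?thesis by blast
qed

end

theory Submission
  imports Defs "HOL-Library.Countable_Set_Type"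
begin

text \<open>
  Passing from \<open>\<omega>\<^sup>\<omega>\<close> or \<open>\<real>\<close> to \<open>2\<^sup>\<omega>\<close> is easy, since partial continuous maps on closed subsets of
  \<open>2\<^sup>\<omega>\<close> extend. For the converse, let \<open>S\<close> be a set of continuous maps on \<open>2\<^sup>\<omega>\<close> whose graphs and
  reflected graphs cover the square, and let \<open>Q\<close> be the countable set of finitely supported
  sequences. Then \<open>2\<^sup>\<omega> - Q\<close> is a union of at most \<open>|S|\<close> compact sets: if some \<open>u\<close> is not of the form
  \<open>f q\<close> with \<open>f \<in> S\<close>, \<open>q \<in> Q\<close>, then every \<open>v \<notin> Q\<close> either equals some \<open>f u\<close> or lies in some fibre
  \<open>f -` {u}\<close>, and these fibres miss \<open>Q\<close>; if there is no such \<open>u\<close>, then \<open>2\<^sup>\<omega>\<close> has at most \<open>|S|\<close> points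
  (up to a countable factor). Since \<open>2\<^sup>\<omega> - Q\<close> maps continuously and bijectively onto \<open>\<omega>\<^sup>\<omega>\<close> and onto
  \<open>(0, 1]\<close>, the maps in \<open>S\<close> can be transported piecewise along these compact sets and then extended
  to the whole space.
\<close>

section \<open>Covers by graphs\<close>

definition sym_graph :: "('a \<Rightarrow> 'a) set \<Rightarrow> ('a \<times> 'a) set" where
  "sym_graph S = {(x, y). \<exists>f\<in>S. f x = y \<or> f y = x}"

text \<open>Covers are handled through functions rather than through members of the ideal, since it
  is functions that can be transported from one space to another.\<close>

definition graph_cover :: "('a::topological_space \<Rightarrow> 'a) set \<Rightarrow> bool" where
  "graph_cover S \<longleftrightarrow> (\<forall>f\<in>S. continuous_on UNIV f) \<and> sym_graph S = UNIV"

lemma graph_coverI: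
  assumes "\<And>f. f \<in> S \<Longrightarrow> continuous_on UNIV f"
    and "\<And>x y. \<exists>f\<in>S. f x = y \<or> f y = x"
  shows "graph_cover S"
  using assms by (auto simp: graph_cover_def sym_graph_def)

lemma graph_coverD:
  assumes "graph_cover S"
  shows "f \<in> S \<Longrightarrow> continuous_on UNIV f" and "\<exists>f\<in>S. f x = y \<or> f y = x"
  using assms by (force simp: graph_cover_def sym_graph_def set_eq_iff)+

lemma sym_graph_in_Cont:
  fixes S :: "('a::topological_space \<Rightarrow> 'a) set"
  assumes "countable S" and "\<And>f. f \<in> S \<Longrightarrow> continuous_on UNIV f"
  shows "sym_graph S \<in> Cont TYPE('a)"
proof -
  let ?G = "(\<lambda>f. {(x, y). f x = y}) ` S \<union> (\<lambda>f. {(y, x). f x = y}) ` S"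
  have "?G \<subseteq> Cont TYPE('a)"
    unfolding Cont_def using assms(2) by (intro subsetI hull_inc) blast
  moreover have "countable ?G"
    using assms(1) by simp
  ultimately have "\<Union>?G \<in> Cont TYPE('a)"
    using sigma_ideal_Cont[where 'a='a] unfolding sigma_ideal_def by blast
  moreover have "\<Union>?G = sym_graph S"
    by (auto simp: sym_graph_def)
  ultimately show ?thesis
    by simp
qed

text \<open>The sets with such a bound form a \<sigma>-ideal containing the generators, so
  minimality of the hull applies.\<close>

lemma Cont_subset_sym_graph:
  fixes A :: "('a::topological_space \<times> 'a) set"
  assumes "A \<in> Cont TYPE('a)"
  shows "\<exists>S. countable S \<and> (\<forall>f\<in>S. continuous_on UNIV f) \<and> A \<subseteq> sym_graph S"
proof -
  let ?I = "{A :: ('a \<times> 'a) set. \<exists>S. countable S \<and> (\<forall>f\<in>S. continuous_on UNIV f) \<and> A \<subseteq> sym_graph S}"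
  have "sigma_ideal ?I"
    unfolding sigma_ideal_def
  proof (intro conjI ballI allI impI)
    show "{} \<in> ?I" by auto
    show "B \<in> ?I" if "A \<in> ?I" "B \<subseteq> A" for A B
      using that by blast
    fix \<A> assume \<A>: "countable \<A> \<and> \<A> \<subseteq> ?I"
    then have "\<forall>A\<in>\<A>. \<exists>S. countable S \<and> (\<forall>f\<in>S. continuous_on UNIV f) \<and> A \<subseteq> sym_graph S"
      by blast
    from bchoice[OF this] obtain T where T: "\<And>A. A \<in> \<A> \<Longrightarrow>
        countable (T A) \<and> (\<forall>f\<in>T A. continuous_on UNIV f) \<and> A \<subseteq> sym_graph (T A)"
      by auto
    have "countable (\<Union>A\<in>\<A>. T A)"
      using \<A> T by (intro countable_UN) auto
    moreover have "\<forall>f\<in>(\<Union>A\<in>\<A>. T A). continuous_on UNIV f"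
      using T by blast
    moreover have "\<Union>\<A> \<subseteq> sym_graph (\<Union>A\<in>\<A>. T A)"
      using T unfolding sym_graph_def by blast
    ultimately show "\<Union>\<A> \<in> ?I" by blast
  qed
  moreover have "{{(x, y). f x = y} | f :: 'a \<Rightarrow> 'a. continuous_on UNIV f} \<union>
      {{(y, x). f x = y} | f :: 'a \<Rightarrow> 'a. continuous_on UNIV f} \<subseteq> ?I"
  proof
    fix B assume "B \<in> {{(x, y). f x = y} | f :: 'a \<Rightarrow> 'a. continuous_on UNIV f} \<union>
      {{(y, x). f x = y} | f :: 'a \<Rightarrow> 'a. continuous_on UNIV f}"
    then obtain f where "continuous_on UNIV f" "B \<subseteq> sym_graph {f}"
      unfolding sym_graph_def by blast
    then show "B \<in> ?I"
      by (intro CollectI exI[of _ "{f}"]) auto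
  qed
  ultimately have "Cont TYPE('a) \<subseteq> ?I"
    unfolding Cont_def by (rule hull_minimal[rotated])
  then show ?thesis
    using assms by blast
qed

section \<open>Cardinal bounds and comparison of covering numbers\<close>

lemma card_of_Times_ordLeq:
  assumes "infinite I" "|A| \<le>o |I|" "|B| \<le>o |I|"
  shows "|A \<times> B| \<le>o |I|"
  using card_of_Times_ordLeq_infinite_Field[of "|I|" A B] assms
  by (simp add: Field_card_of card_of_card_order_on)

lemma card_of_image_ordLeq:
  assumes "|A| \<le>o |I|"
  shows "|f ` A| \<le>o |I|"
  using card_of_image assms by (rule ordLeq_transitive)

lemma countable_ordLeq_infinite:
  assumes "countable A" "infinite I"
  shows "|A| \<le>o |I|"
  using assms countable_card_of_nat infinite_iff_card_of_nat ordLeq_transitive by blast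

text \<open>Each member of a covering family is replaced by countably many functions. An uncountable
  family absorbs the countable factors; a countable one puts the whole target square into the ideal,
  so that one set covers it.\<close>

lemma Cov_Cont_mono:
  assumes transfer: "\<And>S :: ('a::topological_space \<Rightarrow> 'a) set. graph_cover S \<Longrightarrow>
    \<exists>S' :: ('b::topological_space \<Rightarrow> 'b) set. graph_cover S' \<and> |S'| \<le>o |S <+> (UNIV :: nat set)|"
  shows "Cov (Cont TYPE('b)) \<le>o Cov (Cont TYPE('a))"
proof -
  obtain \<F> where \<F>: "covering_family (Cont TYPE('a)) \<F>" "Cov (Cont TYPE('a)) = |\<F>|"
    using Cov_least(1)[OF Union_Cont] by blast
  have "\<forall>A\<in>\<F>. \<exists>S. countable S \<and> (\<forall>f\<in>S. continuous_on UNIV f) \<and> A \<subseteq> sym_graph S"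
    using \<F>(1) Cont_subset_sym_graph unfolding covering_family_def by blast
  from bchoice[OF this] obtain T where T: "\<And>A. A \<in> \<F> \<Longrightarrow>
      countable (T A) \<and> (\<forall>f\<in>T A. continuous_on UNIV f) \<and> A \<subseteq> sym_graph (T A)"
    by auto
  define S where "S = (\<Union>A\<in>\<F>. T A)"
  have "UNIV \<subseteq> sym_graph S"
  proof
    fix p :: "'a \<times> 'a"
    have "p \<in> \<Union>\<F>"
      using \<F>(1) by (simp add: covering_family_def)
    then obtain A where A: "A \<in> \<F>" "p \<in> A"
      by (rule UnionE)
    then have "p \<in> sym_graph (T A)" "T A \<subseteq> S"
      using T[OF A(1)] by (auto simp: S_def)
    then show "p \<in> sym_graph S"
      unfolding sym_graph_def by blast
  qed
  then have "graph_cover S"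
    using T unfolding graph_cover_def S_def by (auto simp: top.extremum_unique)
  then obtain S' :: "('b \<Rightarrow> 'b) set" where S': "graph_cover S'" "|S'| \<le>o |S <+> (UNIV :: nat set)|"
    using transfer by blast
  show ?thesis
  proof (cases "countable \<F>")
    case True
    then have "countable S"
      unfolding S_def using T by (intro countable_UN) auto
    then have "countable (S <+> (UNIV :: nat set))"
      by simp
    then have "countable S'"
      using S'(2) countable_ordLeq by blast
    then have "UNIV \<in> Cont TYPE('b)"
      using sym_graph_in_Cont[of S'] S'(1) unfolding graph_cover_def by simp
    then have "covering_family (Cont TYPE('b)) {UNIV}"
      by (simp add: covering_family_def)
    then have "Cov (Cont TYPE('b)) \<le>o |{UNIV :: ('b \<times> 'b) set}|"
      by (rule Cov_least(2)[OF Union_Cont])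
    \<comment> \<open>The family \<open>\<F>\<close> is nonempty because it covers a nonempty
      square.\<close>
    moreover have "|{UNIV :: ('b \<times> 'b) set}| \<le>o |\<F>|"
      using \<F>(1) unfolding covering_family_def by (intro card_of_singl_ordLeq) auto
    ultimately show ?thesis
      unfolding \<F>(2) by (rule ordLeq_transitive)
  next
    case False
    then have inf: "infinite \<F>"
      using countable_finite by blast
    have "\<forall>A\<in>\<F>. |T A| \<le>o |\<F>|"
      using T countable_ordLeq_infinite[OF _ inf] by blast
    then have "|S| \<le>o |\<F>|"
      unfolding S_def
      by (intro card_of_UNION_ordLeq_infinite inf ordLeq_refl card_of_Card_order)
    moreover have "|UNIV :: nat set| \<le>o |\<F>|"
      using inf by (simp add: infinite_iff_card_of_nat)
    ultimately have "|S <+> (UNIV :: nat set)| \<le>o |\<F>|"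
      using card_of_Plus_ordLeq_infinite_Field[of "|\<F>|"] inf
      by (simp add: Field_card_of card_of_card_order_on)
    with S'(2) have "|S'| \<le>o |\<F>|"
      by (rule ordLeq_transitive)
    then have le: "|(\<lambda>f. sym_graph {f}) ` S'| \<le>o |\<F>|"
      by (rule card_of_image_ordLeq)
    have "\<Union>((\<lambda>f. sym_graph {f}) ` S') = sym_graph S'"
      by (auto simp: sym_graph_def)
    then have "covering_family (Cont TYPE('b)) ((\<lambda>f. sym_graph {f}) ` S')"
      using S'(1) unfolding covering_family_def graph_cover_def
      by (auto intro!: sym_graph_in_Cont)
    then have "Cov (Cont TYPE('b)) \<le>o |(\<lambda>f. sym_graph {f}) ` S'|"
      by (rule Cov_least(2)[OF Union_Cont])
    then show ?thesis
      using le unfolding \<F>(2) by (rule ordLeq_transitive)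
  qed
qed

section \<open>Sequence spaces over discrete alphabets\<close>

lemma open_contains_cylinder:
  fixes x :: "nat \<Rightarrow> 'b::topological_space"
  assumes "open U" "x \<in> U"
  shows "\<exists>n. \<forall>y. (\<forall>i<n. y i = x i) \<longrightarrow> y \<in> U"
proof -
  obtain X where X: "x \<in> Pi\<^sub>E UNIV X" "finite {i. X i \<noteq> UNIV}" "Pi\<^sub>E UNIV X \<subseteq> U"
    using product_topology_open_contains_basis[of "\<lambda>_. euclidean" UNIV U x] assms
    by (auto simp: open_fun_def)
  obtain n where n: "\<forall>i\<in>{i. X i \<noteq> UNIV}. i < n"
    using X(2) finite_nat_set_iff_bounded by blast
  have "y \<in> U" if "\<forall>i<n. y i = x i" for y
  proof -
    have "y i \<in> X i" for i
      using that n X(1) by (cases "X i = UNIV") (auto simp: PiE_iff)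
    then show ?thesis
      using X(3) by (auto simp: PiE_iff)
  qed
  then show ?thesis by blast
qed

lemma open_cylinder:
  fixes x :: "nat \<Rightarrow> 'b::discrete_topology"
  shows "open {y. \<forall>i<n. y i = x i}"
proof -
  have "open (\<Inter>i<n. (\<lambda>y. y i) -` {x i})"
    by (intro open_INT ballI open_vimage) (auto simp: open_discrete)
  moreover have "(\<Inter>i<n. (\<lambda>y. y i) -` {x i}) = {y. \<forall>i<n. y i = x i}"
    by auto
  ultimately show ?thesis by simp
qed

text \<open>Around each point \<open>g\<close> is constant on the trace of an open cylinder,
  whatever the topology of the target.\<close>

lemma continuous_on_finitely_determined:
  fixes g :: "(nat \<Rightarrow> 'b::discrete_topology) \<Rightarrow> 'c::topological_space"
  assumes "\<And>x. x \<in> D \<Longrightarrow> \<exists>n. \<forall>y\<in>D. (\<forall>i<n. y i = x i) \<longrightarrow> g y = g x"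
  shows "continuous_on D g"
  unfolding continuous_on_topological
proof (intro ballI allI impI)
  fix x B assume "x \<in> D" "open B" "g x \<in> B"
  then obtain n where "\<forall>y\<in>D. (\<forall>i<n. y i = x i) \<longrightarrow> g y = g x"
    using assms by blast
  with \<open>g x \<in> B\<close> show "\<exists>A. open A \<and> x \<in> A \<and> (\<forall>y\<in>D. y \<in> A \<longrightarrow> g y \<in> B)"
    by (intro exI[of _ "{y. \<forall>i<n. y i = x i}"]) (auto simp: open_cylinder)
qed

text \<open>Compactness yields a single \<open>N\<close> such that \<open>g\<close> depends only on
  the first \<open>N\<close> entries; the extension reads the same prefix everywhere.\<close>

lemma continuous_extension_discrete:
  fixes g :: "(nat \<Rightarrow> 'b::discrete_topology) \<Rightarrow> 'c::discrete_topology"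
  assumes "compact D" "continuous_on D g"
  shows "\<exists>h. continuous_on UNIV h \<and> (\<forall>x\<in>D. h x = g x)"
proof -
  have "\<exists>n. \<forall>y\<in>D. (\<forall>i<n. y i = x i) \<longrightarrow> g y = g x" if x: "x \<in> D" for x
  proof -
    obtain A where "open A" "x \<in> A" "\<forall>y\<in>D. y \<in> A \<longrightarrow> g y \<in> {g x}"
      using assms(2)[unfolded continuous_on_topological, rule_format, OF x open_discrete singletonI]
      by blast
    then show ?thesis
      using open_contains_cylinder[of A x] by blast
  qed
  then obtain n where n: "\<And>x y. x \<in> D \<Longrightarrow> y \<in> D \<Longrightarrow> \<forall>i<n x. y i = x i \<Longrightarrow> g y = g x"
    by metis
  obtain F where F: "F \<subseteq> D" "finite F" "D \<subseteq> (\<Union>x\<in>F. {y. \<forall>i<n x. y i = x i})"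
    by (rule compactE_image[OF assms(1), of D "\<lambda>x. {y. \<forall>i<n x. y i = x i}"])
      (auto simp: open_cylinder)
  obtain N where N: "\<forall>x\<in>F. n x \<le> N"
    using F(2) finite_nat_set_iff_bounded_le[of "n ` F"] by auto
  have same: "g y = g z" if yz: "y \<in> D" "z \<in> D" "\<forall>i<N. y i = z i" for y z
  proof -
    obtain x where x: "x \<in> F" "\<forall>i<n x. y i = x i"
      using F(3) yz(1) by blast
    then have "\<forall>i<n x. z i = x i"
      using N yz(3) by (metis order_less_le_trans)
    then show ?thesis
      using x n[of x y] n[of x z] yz F(1) by auto
  qed
  \<comment> \<open>If no point of \<open>D\<close> has the prefix of \<open>x\<close>, the choice
    is arbitrary, but it still depends on that prefix only, which keeps \<open>h\<close>
    continuous.\<close>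
  define h where "h x = g (SOME z. z \<in> D \<and> (\<forall>i<N. z i = x i))" for x
  have "h x = g x" if "x \<in> D" for x
  proof -
    have "(SOME z. z \<in> D \<and> (\<forall>i<N. z i = x i)) \<in> D \<and>
        (\<forall>i<N. (SOME z. z \<in> D \<and> (\<forall>i<N. z i = x i)) i = x i)"
      by (rule someI[of _ x]) (use that in auto)
    then show ?thesis
      unfolding h_def using same that by blast
  qed
  moreover have "continuous_on UNIV h"
  proof (rule continuous_on_finitely_determined, intro exI ballI impI)
    fix x y :: "nat \<Rightarrow> 'b" assume "\<forall>i<N. y i = x i"
    then have "(\<lambda>z. z \<in> D \<and> (\<forall>i<N. z i = y i)) = (\<lambda>z. z \<in> D \<and> (\<forall>i<N. z i = x i))"
      by auto
    then show "h y = h x"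
      unfolding h_def by simp
  qed
  ultimately show ?thesis by blast
qed

lemma continuous_extension_sequences:
  fixes g :: "(nat \<Rightarrow> 'b::discrete_topology) \<Rightarrow> nat \<Rightarrow> 'c::discrete_topology"
  assumes "compact D" "continuous_on D g"
  shows "\<exists>h. continuous_on UNIV h \<and> (\<forall>x\<in>D. h x = g x)"
proof -
  have "\<forall>i. \<exists>h. continuous_on UNIV h \<and> (\<forall>x\<in>D. h x = g x i)"
    by (rule allI, rule continuous_extension_discrete[OF assms(1)],
        rule continuous_on_product_then_coordinatewise[OF assms(2)])
  then obtain h where h: "\<And>i. continuous_on UNIV (h i)" "\<And>i x. x \<in> D \<Longrightarrow> h i x = g x i"
    by metis
  have "continuous_on UNIV (\<lambda>x i. h i x)"
    by (intro continuous_on_coordinatewise_then_product) (simp add: h)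
  then show ?thesis
    using h(2) by (intro exI[of _ "\<lambda>x i. h i x"]) auto
qed

section \<open>Compact and closed sets in sequence spaces\<close>

lemma compact_UNIV_Cantor: "compact (UNIV :: (nat \<Rightarrow> bool) set)"
proof -
  have "compactin (product_topology (\<lambda>_::nat. euclidean :: bool topology) UNIV) (Pi\<^sub>E UNIV (\<lambda>_. UNIV))"
    unfolding compactin_PiE by (simp add: finite_imp_compact)
  then show ?thesis
    by (simp add: euclidean_product_topology)
qed

lemma compact_closed_Cantor:
  fixes D :: "(nat \<Rightarrow> bool) set"
  assumes "closed D"
  shows "compact D"
  using compact_Int_closed[OF compact_UNIV_Cantor assms] by simp

text \<open>Function types carry no \<^class>\<open>t2_space\<close> instance over a discrete alphabet, so the Hausdorff
  property enters below only through the closedness of compact sets.\<close>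

lemma compact_imp_closed_sequences:
  fixes K :: "(nat \<Rightarrow> 'b::t2_space) set"
  assumes "compact K"
  shows "closed K"
proof -
  have "Hausdorff_space (euclidean :: 'b topology)"
    unfolding Hausdorff_space_def disjnt_def using hausdorff by fastforce
  then have "Hausdorff_space (product_topology (\<lambda>_::nat. euclidean :: 'b topology) UNIV)"
    unfolding Hausdorff_space_product_topology by blast
  then have "Hausdorff_space (euclidean :: (nat \<Rightarrow> 'b) topology)"
    by (simp add: euclidean_product_topology)
  then show ?thesis
    using compactin_imp_closedin[of euclidean K] assms by simp
qed

text \<open>A continuous injection on a compact set is a homeomorphism onto its image: relatively
  closed sets have compact, hence closed, images. The first assumption stands in for the Hausdorff
  property.\<close>

lemma continuous_on_inverse_compact:
  fixes f :: "'a::topological_space \<Rightarrow> 'b::topological_space" and g :: "'b \<Rightarrow> 'a"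
  assumes closed: "\<And>K :: 'b set. compact K \<Longrightarrow> closed K"
    and f: "continuous_on D f" "compact D" and inv: "\<And>x. x \<in> D \<Longrightarrow> g (f x) = x"
  shows "continuous_on (f ` D) g"
  unfolding continuous_on_closed_invariant
proof (intro allI impI)
  fix B :: "'a set" assume "closed B"
  then have "compact (D \<inter> B)"
    using f(2) by (simp add: compact_Int_closed)
  then have "closed (f ` (D \<inter> B))"
    using f(1) by (intro closed compact_continuous_image) (auto intro: continuous_on_subset)
  moreover have "f ` (D \<inter> B) \<inter> f ` D = g -` B \<inter> f ` D"
    using inv by auto
  ultimately show "\<exists>A. closed A \<and> A \<inter> f ` D = g -` B \<inter> f ` D"
    by blast
qed

lemma closed_singleton_Cantor: "closed {u :: nat \<Rightarrow> bool}"
  by (intro compact_imp_closed_sequences finite_imp_compact) simp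

section \<open>From the Cantor space to larger spaces\<close>

text \<open>Closed subsets of the Cantor space are compact, so this splits \<open>- Q\<close> into
  few compact pieces, on each of which a continuous injection is an embedding.\<close>

lemma closed_cover_of_co_countable:
  fixes S :: "((nat \<Rightarrow> bool) \<Rightarrow> nat \<Rightarrow> bool) set"
  assumes S: "graph_cover S" and Q: "countable (Q :: (nat \<Rightarrow> bool) set)" and I: "infinite I" "|S| \<le>o |I|"
  shows "\<exists>\<K>. |\<K>| \<le>o |I| \<and> (\<forall>K\<in>\<K>. closed K \<and> K \<subseteq> - Q) \<and> \<Union>\<K> = - Q"
proof (cases "(\<Union>f\<in>S. f ` Q) = UNIV")
  case True
  have "|\<Union>f\<in>S. f ` Q| \<le>o |I|"
    using I Q by (intro card_of_UNION_ordLeq_infinite) (auto intro: countable_ordLeq_infinite)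
  then have "|UNIV :: (nat \<Rightarrow> bool) set| \<le>o |I|"
    by (simp only: True)
  then have "|- Q| \<le>o |I|"
    by (rule ordLeq_transitive[OF card_of_mono1, rotated]) simp
  then have "|(\<lambda>x. {x}) ` (- Q)| \<le>o |I|"
    by (rule card_of_image_ordLeq)
  then show ?thesis
    by (intro exI[of _ "(\<lambda>x. {x}) ` (- Q)"]) (auto simp: closed_singleton_Cantor)
next
  case False
  then obtain u where u: "\<And>f q. f \<in> S \<Longrightarrow> q \<in> Q \<Longrightarrow> u \<noteq> f q"
    by blast
  \<comment> \<open>For \<open>v\<close> outside \<open>Q\<close>, the cover relates
    \<open>u\<close> and \<open>v\<close>: either \<open>f v = u\<close>, so \<open>v\<close> lies
    in a fibre, or \<open>f u = v\<close>, so \<open>v\<close> is the point of a singleton.\<close>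
  define \<K> where "\<K> = (\<lambda>f. f -` {u}) ` S \<union> (\<lambda>f. {f u} - Q) ` S"
  have "|\<K>| \<le>o |I|"
    unfolding \<K>_def
    by (rule card_of_Un_ordLeq_infinite_Field)
      (use I in \<open>simp_all add: card_of_image_ordLeq Field_card_of card_of_card_order_on\<close>)
  moreover have "closed K \<and> K \<subseteq> - Q" if "K \<in> \<K>" for K
    using that unfolding \<K>_def
  proof
    assume "K \<in> (\<lambda>f. f -` {u}) ` S"
    then obtain f where f: "f \<in> S" "K = f -` {u}" by blast
    then have "closed K"
      using closed_vimage[OF closed_singleton_Cantor] graph_coverD(1)[OF S] by blast
    then show ?thesis
      using f u by blast
  next
    assume "K \<in> (\<lambda>f. {f u} - Q) ` S"
    then obtain f where "K = {f u} - Q" by blast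
    then show ?thesis
      using closed_singleton_Cantor by (cases "f u \<in> Q") (auto simp: insert_Diff_if)
  qed
  moreover have "v \<in> \<Union>\<K>" if "v \<notin> Q" for v
    using graph_coverD(2)[OF S, of u v] that unfolding \<K>_def by blast
  ultimately show ?thesis
    by (intro exI[of _ \<K>]) blast
qed

text \<open>Each \<open>f\<close> is restricted to the points of one compact piece whose values lie
  in another, conjugated by the coding maps and extended. Countably many coding maps are allowed
  because the line is covered by countably many copies of \<open>(0, 1]\<close>.\<close>

lemma graph_cover_from_Cantor:
  fixes b :: "nat \<Rightarrow> (nat \<Rightarrow> bool) \<Rightarrow> 'b::topological_space"
    and S :: "((nat \<Rightarrow> bool) \<Rightarrow> nat \<Rightarrow> bool) set"
  assumes Q: "countable Q"
    and cont: "\<And>n. continuous_on (- Q) (b n)" and inj: "\<And>n. inj_on (b n) (- Q)"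
    and onto: "(\<Union>n. b n ` (- Q)) = UNIV"
    and closed: "\<And>K :: 'b set. compact K \<Longrightarrow> closed K"
    and extension: "\<And>D (g :: 'b \<Rightarrow> 'b). compact D \<Longrightarrow> continuous_on D g \<Longrightarrow>
      \<exists>h. continuous_on UNIV h \<and> (\<forall>x\<in>D. h x = g x)"
    and S: "graph_cover S"
  shows "\<exists>S' :: ('b \<Rightarrow> 'b) set. graph_cover S' \<and> |S'| \<le>o |S <+> (UNIV :: nat set)|"
proof -
  let ?I = "S <+> (UNIV :: nat set)"
  have inf: "infinite ?I"
    by (simp add: finite_Plus_iff)
  have le_S: "|S| \<le>o |?I|"
    by (rule card_of_Plus1)
  have le_nat: "|UNIV :: nat set| \<le>o |?I|"
    by (rule card_of_Plus2)
  obtain \<K> where \<K>: "|\<K>| \<le>o |?I|" "\<And>K. K \<in> \<K> \<Longrightarrow> closed K \<and> K \<subseteq> - Q" "\<Union>\<K> = - Q"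
    using closed_cover_of_co_countable[OF S Q inf le_S] by blast
  \<comment> \<open>An index holds the coding maps for argument and value, the pieces containing
    their codes, and the function to be transported.\<close>
  define P where "P = (UNIV :: nat set) \<times> (UNIV :: nat set) \<times> \<K> \<times> \<K> \<times> S"
  have "\<exists>h. continuous_on UNIV h \<and> (\<forall>k\<in>K. f k \<in> K' \<longrightarrow> h (b m k) = b n (f k))"
    if "(m, n, K, K', f) \<in> P" for m n K K' f
  proof -
    have f: "continuous_on UNIV f" and K: "closed K" "K \<subseteq> - Q" and K': "closed K'" "K' \<subseteq> - Q"
      using that \<K>(2) graph_coverD(1)[OF S] unfolding P_def by auto
    let ?D = "K \<inter> f -` K'"
    let ?inv = "inv_into (- Q) (b m)"
    have "closed ?D"
      using K K' f by (intro closed_Int closed_vimage)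
    then have D: "compact ?D"
      by (rule compact_closed_Cantor)
    have contD: "continuous_on ?D (b m)"
      using cont K(2) by (blast intro: continuous_on_subset)
    have inv: "?inv (b m k) = k" if "k \<in> ?D" for k
      using that K(2) inj by (intro inv_into_f_f) auto
    have "continuous_on (b m ` ?D) ?inv"
      using closed contD D inv by (rule continuous_on_inverse_compact)
    moreover have img: "?inv ` b m ` ?D = ?D"
      unfolding image_image using inv by (rule image_cong[OF refl, THEN trans]) auto
    ultimately have "continuous_on (b m ` ?D) (f \<circ> ?inv)"
      using f by (intro continuous_on_compose) (auto intro: continuous_on_subset)
    \<comment> \<open>On \<open>?D\<close> the values of \<open>f\<close> lie in \<open>K'\<close>,
      hence outside \<open>Q\<close>, where \<open>b n\<close> is continuous.\<close>
    moreover have "(f \<circ> ?inv) ` b m ` ?D \<subseteq> - Q"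
      using img K'(2) by (auto simp: image_comp[symmetric])
    ultimately have "continuous_on (b m ` ?D) (b n \<circ> (f \<circ> ?inv))"
      by (rule continuous_on_compose[OF _ continuous_on_subset[OF cont]])
    from extension[OF compact_continuous_image[OF contD D] this] obtain h
      where "continuous_on UNIV h" "\<forall>x\<in>b m ` ?D. h x = (b n \<circ> (f \<circ> ?inv)) x"
      by (elim exE conjE)
    then show ?thesis
      using inv by (intro exI[of _ h]) auto
  qed
  then have "\<forall>p\<in>P. \<exists>h. continuous_on UNIV h \<and>
      (case p of (m, n, K, K', f) \<Rightarrow> \<forall>k\<in>K. f k \<in> K' \<longrightarrow> h (b m k) = b n (f k))"
    by auto
  from bchoice[OF this] obtain h where h: "\<And>p. p \<in> P \<Longrightarrow> continuous_on UNIV (h p)"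
    "\<And>m n K K' f k. (m, n, K, K', f) \<in> P \<Longrightarrow> k \<in> K \<Longrightarrow> f k \<in> K' \<Longrightarrow>
      h (m, n, K, K', f) (b m k) = b n (f k)"
    by fastforce
  have "|P| \<le>o |?I|"
    unfolding P_def by (intro card_of_Times_ordLeq inf le_S le_nat \<K>(1))
  then have "|h ` P| \<le>o |?I|"
    by (rule card_of_image_ordLeq)
  moreover have "graph_cover (h ` P)"
  proof (rule graph_coverI)
    show "continuous_on UNIV g" if "g \<in> h ` P" for g
      using that h(1) by blast
    fix x y :: 'b
    have "x \<in> (\<Union>n. b n ` (- Q))" "y \<in> (\<Union>n. b n ` (- Q))"
      unfolding onto by auto
    then obtain m n k l where kl: "k \<in> - Q" "l \<in> - Q" and x: "x = b m k" and y: "y = b n l"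
      by blast
    from kl obtain K L where KL: "K \<in> \<K>" "k \<in> K" "L \<in> \<K>" "l \<in> L"
      unfolding \<K>(3)[symmetric] by (elim UnionE)
    obtain f where f: "f \<in> S" "f k = l \<or> f l = k"
      using graph_coverD(2)[OF S] by blast
    \<comment> \<open>The cover may relate \<open>k\<close> and \<open>l\<close> in either
      direction, so both orders of the index are prepared.\<close>
    have P: "(m, n, K, L, f) \<in> P" "(n, m, L, K, f) \<in> P"
      using KL f by (auto simp: P_def)
    have "h (m, n, K, L, f) x = y \<or> h (n, m, L, K, f) y = x"
      using f(2) h(2)[OF P(1) KL(2)] h(2)[OF P(2) KL(4)] KL(2,4) x y by auto
    then show "\<exists>g\<in>h ` P. g x = y \<or> g y = x"
      using P by blast
  qed
  ultimately show ?thesis by blast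
qed

text \<open>The complement consists of the sequences with infinitely many ones; it codes the Baire
  space by gaps between ones and \<open>(0, 1]\<close> by nonterminating binary expansions.\<close>

definition fin_support :: "(nat \<Rightarrow> bool) set" where
  "fin_support = {x. finite (Collect x)}"

lemma countable_fin_support: "countable fin_support"
proof -
  have "fin_support = (\<lambda>A n. n \<in> A) ` {A. finite A}"
    by (auto simp: fin_support_def image_iff intro!: exI[of _ "Collect _"])
  moreover have "countable {A :: nat set. finite A}"
    by (rule countable_Collect_finite)
  ultimately show ?thesis
    by (metis countable_image)
qed

lemma infinite_support: "x \<in> - fin_support \<Longrightarrow> infinite (Collect x)"
  by (simp add: fin_support_def)

section \<open>The Baire space\<close>

text \<open>Finding the \<open>n\<close>-th member of a set inspects the set only up to that member.
  This is what makes \<open>gaps\<close> continuous.\<close>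

lemma enumerate_eq_if_agree:
  fixes A B :: "nat set"
  assumes "infinite A" "infinite B" "\<And>i. i \<le> enumerate A n \<Longrightarrow> i \<in> A \<longleftrightarrow> i \<in> B"
  shows "enumerate B n = enumerate A n"
  using assms(3)
proof (induction n)
  case 0
  have "enumerate A 0 \<in> B"
    using 0 enumerate_in_set[OF assms(1), of 0] by blast
  moreover have "enumerate A 0 \<le> i" if "i \<in> B" for i
    using that 0[of i] by (metis enumerate_0 Least_le linear)
  ultimately show ?case
    unfolding enumerate_0[of B] by (intro Least_equality)
next
  case (Suc n)
  have less: "enumerate A n < enumerate A (Suc n)"
    using assms(1) by (rule enumerate_step)
  then have IH: "enumerate B n = enumerate A n"
    using Suc by simp
  have "enumerate A (Suc n) \<in> B"
    using Suc.prems enumerate_in_set[OF assms(1), of "Suc n"] by blast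
  moreover have "enumerate A (Suc n) \<le> i" if "i \<in> B" "enumerate A n < i" for i
    using that Suc.prems[of i] unfolding enumerate_Suc''[OF assms(1)]
    by (metis (no_types, lifting) Least_le linear)
  ultimately show ?case
    unfolding enumerate_Suc''[OF assms(2)] IH using less by (intro Least_equality) auto
qed

lemma enumerate_range_strict_mono:
  fixes s :: "nat \<Rightarrow> nat"
  assumes "strict_mono s"
  shows "enumerate (range s) n = s n"
proof (induction n)
  case 0
  show ?case
    unfolding enumerate_0 using assms by (intro Least_equality) (auto simp: strict_mono_less_eq)
next
  case (Suc n)
  have "infinite (range s)"
    using assms by (simp add: range_inj_infinite strict_mono_imp_inj_on)
  then show ?case
    unfolding enumerate_Suc''[OF \<open>infinite (range s)\<close>] Suc using assms
    by (intro Least_equality) (auto simp: strict_mono_less strict_mono_less_eq)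
qed

text \<open>These are the lengths of the blocks of zeros before successive ones. For infinite
  support the enumeration increases strictly, so the subtractions never truncate.\<close>

fun gaps :: "(nat \<Rightarrow> bool) \<Rightarrow> nat \<Rightarrow> nat" where
  "gaps x 0 = enumerate (Collect x) 0"
| "gaps x (Suc n) = enumerate (Collect x) (Suc n) - enumerate (Collect x) n - 1"

lemma continuous_on_gaps: "continuous_on (- fin_support) gaps"
proof (rule continuous_on_coordinatewise_then_product)
  fix n
  show "continuous_on (- fin_support) (\<lambda>x. gaps x n)"
  proof (rule continuous_on_finitely_determined, intro exI ballI impI)
    fix x y
    assume xy: "x \<in> - fin_support" "y \<in> - fin_support"
      "\<forall>i<Suc (enumerate (Collect x) n). y i = x i"
    have "enumerate (Collect y) m = enumerate (Collect x) m" if "m \<le> n" for m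
    proof (rule enumerate_eq_if_agree)
      fix i assume "i \<le> enumerate (Collect x) m"
      also have "\<dots> \<le> enumerate (Collect x) n"
        using that infinite_support[OF xy(1)] by simp
      finally show "i \<in> Collect x \<longleftrightarrow> i \<in> Collect y"
        using xy(3) by simp
    qed (use xy infinite_support in auto)
    then show "gaps y n = gaps x n"
      by (cases n) auto
  qed
qed

lemma inj_on_gaps: "inj_on gaps (- fin_support)"
proof
  fix x y assume xy: "x \<in> - fin_support" "y \<in> - fin_support" "gaps x = gaps y"
  have "enumerate (Collect x) n = enumerate (Collect y) n" for n
  proof (induction n)
    case 0
    then show ?case
      using fun_cong[OF xy(3), of 0] by simp
  next
    case (Suc n)
    then show ?case
      using fun_cong[OF xy(3), of "Suc n"] enumerate_step[of "Collect x" n]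
        enumerate_step[of "Collect y" n] xy(1,2) infinite_support by fastforce
  qed
  then have "range (enumerate (Collect x)) = range (enumerate (Collect y))"
    by presburger
  then have "Collect x = Collect y"
    using xy(1,2) infinite_support range_enumerate by metis
  then show "x = y"
    by (auto simp: set_eq_iff)
qed

lemma gaps_onto: "gaps ` (- fin_support) = UNIV"
proof -
  have "y \<in> gaps ` (- fin_support)" for y :: "nat \<Rightarrow> nat"
  proof
    \<comment> \<open>\<open>s n\<close> is the intended position of the \<open>n\<close>-th one:
      before it come the zero blocks of lengths \<open>y 0\<close> to \<open>y n\<close> and
      \<open>n\<close> earlier ones.\<close>
    define s where "s n = (\<Sum>k\<le>n. y k) + n" for n
    have "strict_mono s"
      by (rule strict_monoI_Suc) (simp add: s_def)
    define x where "x i \<longleftrightarrow> i \<in> range s" for i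
    have x: "Collect x = range s"
      by (auto simp: x_def)
    show "x \<in> - fin_support"
      using \<open>strict_mono s\<close>
      by (simp add: fin_support_def x range_inj_infinite strict_mono_imp_inj_on)
    show "y = gaps x"
    proof
      fix n show "y n = gaps x n"
        using enumerate_range_strict_mono[OF \<open>strict_mono s\<close>] 
        by (cases n) (simp_all add: x, simp_all add: s_def)
    qed
  qed
  then show ?thesis by blast
qed

section \<open>The real line\<close>

text \<open>With \<open>r = 1/2\<close> this is binary expansion; with \<open>r = 1/3\<close> the
  range is the middle-thirds set scaled by one half.\<close>

definition digit_sum :: "real \<Rightarrow> (nat \<Rightarrow> bool) \<Rightarrow> real" where
  "digit_sum r x = (\<Sum>n. of_bool (x n) * r ^ Suc n)"

lemma summable_digits:
  fixes r :: real
  assumes "0 < r" "r < 1"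
  shows "summable (\<lambda>n. of_bool (x n) * r ^ Suc (n + m))"
proof (rule summable_comparison_test')
  show "summable (\<lambda>n. r ^ Suc m * r ^ n)"
    using assms by (intro summable_mult summable_geometric) auto
  show "norm (of_bool (x n) * r ^ Suc (n + m)) \<le> r ^ Suc m * r ^ n" for n
    using assms by (simp add: power_add abs_mult mult_ac)
qed

text \<open>The partial sums depend on finitely many digits and converge uniformly by the
  Weierstrass test.\<close>

lemma continuous_on_digit_sum:
  assumes "0 < r" "r < 1"
  shows "continuous_on UNIV (digit_sum r)"
proof -
  have "uniform_limit UNIV (\<lambda>n x. \<Sum>i<n. of_bool (x i) * r ^ Suc i)
      (\<lambda>x. \<Sum>n. of_bool (x n) * r ^ Suc n) sequentially"
  proof (rule Weierstrass_m_test)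
    show "summable (\<lambda>n. r ^ Suc n)"
      using assms by (simp add: summable_geometric summable_mult)
    show "norm (of_bool (x n) * r ^ Suc n) \<le> r ^ Suc n" for n and x :: "nat \<Rightarrow> bool"
      using assms by (simp add: abs_mult)
  qed
  moreover have "continuous_on UNIV (\<lambda>x. \<Sum>i<n. of_bool (x i) * r ^ Suc i)" for n
    by (rule continuous_on_finitely_determined) (auto intro!: exI[of _ n] sum.cong)
  ultimately show ?thesis
    unfolding digit_sum_def[abs_def] by (intro uniform_limit_theorem) auto
qed

text \<open>At the first difference \<open>x\<close> gains \<open>r ^ Suc n\<close>, while the tail
  of \<open>y\<close> is at most \<open>r / (1 - r) \<le> 1\<close> times that. Strictness comes
  from \<open>r < 1/2\<close> or from a later one in \<open>x\<close>.\<close>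

lemma digit_sum_less:
  assumes r: "0 < r" "r \<le> 1/2" "r < 1/2 \<or> (\<exists>k>n. x k)"
    and xy: "\<And>k. k < n \<Longrightarrow> x k = y k" "x n" "\<not> y n"
  shows "digit_sum r y < digit_sum r x"
proof -
  \<comment> \<open>The part of the sum beyond position \<open>n\<close>.\<close>
  define t where "t z = (\<Sum>k. of_bool (z (k + Suc n)) * r ^ Suc (k + Suc n))" for z :: "nat \<Rightarrow> bool"
  have sm: "summable (\<lambda>k. of_bool (z k) * r ^ Suc (k + m))" for z m
    using r by (intro summable_digits) auto
  have split: "digit_sum r z = t z + (\<Sum>k<Suc n. of_bool (z k) * r ^ Suc k)" for z
    unfolding digit_sum_def t_def using sm[of z 0]
    by (intro suminf_split_initial_segment) simp
  have prefix: "(\<Sum>k<n. of_bool (x k) * r ^ Suc k) = (\<Sum>k<n. of_bool (y k) * r ^ Suc k)"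
    using xy(1) by (intro sum.cong) auto
  have geo: "(\<lambda>k. r ^ Suc (k + Suc n)) sums (r ^ Suc n * (r / (1 - r)))"
    using sums_mult[OF geometric_sums[of r], of "r ^ Suc (Suc n)"] r
    by (simp add: power_add mult_ac)
  have "t y \<le> (\<Sum>k. r ^ Suc (k + Suc n))"
    unfolding t_def using r sm[of "\<lambda>k. y (k + Suc n)" "Suc n"] geo
    by (intro suminf_le) (auto simp: sums_iff)
  then have ty: "t y \<le> r ^ Suc n * (r / (1 - r))"
    using geo by (simp add: sums_iff)
  have tx: "0 \<le> t x"
    unfolding t_def using r sm[of "\<lambda>k. x (k + Suc n)" "Suc n"] by (intro suminf_nonneg) auto
  have "t y < r ^ Suc n + t x"
    using r(3)
  proof
    assume "r < 1/2"
    then have "r ^ Suc n * (r / (1 - r)) < r ^ Suc n * 1"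
      using r(1) by (intro mult_strict_left_mono) (auto simp: field_simps)
    then show ?thesis using ty tx by simp
  next
    assume "\<exists>k>n. x k"
    then obtain k where "n < k" "x k" by blast
    then obtain j where j: "x (j + Suc n)"
      by (metis add.commute less_iff_Suc_add add_Suc_right)
    have "0 < t x"
      unfolding t_def using r sm[of "\<lambda>k. x (k + Suc n)" "Suc n"] j
      by (intro suminf_pos2[of _ j]) auto
    moreover have "r ^ Suc n * (r / (1 - r)) \<le> r ^ Suc n * 1"
      using r by (intro mult_left_mono) (auto simp: field_simps)
    ultimately show ?thesis using ty by simp
  qed
  then show ?thesis
    unfolding split using prefix xy(2,3) by simp
qed

lemma inj_on_digit_sum:
  assumes r: "0 < r" "r \<le> 1/2" "\<And>x n. x \<in> A \<Longrightarrow> r < 1/2 \<or> (\<exists>k>n. x k)"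
  shows "inj_on (digit_sum r) A"
proof (rule inj_onI, rule ccontr)
  fix x y assume xy: "x \<in> A" "y \<in> A" "digit_sum r x = digit_sum r y" "x \<noteq> y"
  then have "\<exists>n. x n \<noteq> y n" by blast
  define n where "n = (LEAST n. x n \<noteq> y n)"
  have n: "x n \<noteq> y n"
    unfolding n_def using \<open>\<exists>n. x n \<noteq> y n\<close> by (rule LeastI_ex)
  have below: "x k = y k" if "k < n" for k
    using that not_less_Least unfolding n_def by blast
  show False
  proof (cases "x n")
    case True
    then have "digit_sum r y < digit_sum r x"
      using n below r xy(1) by (intro digit_sum_less[of r n]) auto
    then show ?thesis using xy(3) by simp
  next
    case False
    then have "digit_sum r x < digit_sum r y"
      using n below r xy(2) by (intro digit_sum_less[of r n]) auto
    then show ?thesis using xy(3) by simp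
  qed
qed

lemma binary_expansion:
  assumes y: "0 < y" "y \<le> 1"
  shows "y \<in> digit_sum (1/2) ` (- fin_support)"
proof
  \<comment> \<open>Ceilings instead of floors select the expansion with infinitely many ones.\<close>
  define c where "c n = \<lceil>2 ^ n * y\<rceil> - 1" for n :: nat
  define x where "x n \<longleftrightarrow> odd (c (Suc n))" for n
  have c_less: "of_int (c n) < 2 ^ n * y" and c_ge: "2 ^ n * y \<le> of_int (c n) + 1" for n
    unfolding c_def by linarith+
  \<comment> \<open>The bounds place the integer \<open>c (Suc n)\<close> strictly between
    \<open>2 * c n - 1\<close> and \<open>2 * c n + 2\<close>; parity then selects the
    digit.\<close>
  have c_Suc: "c (Suc n) = 2 * c n + of_bool (x n)" for n
  proof -
    have "of_int (c (Suc n)) < (2 * of_int (c n) + 2 :: real)"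
      using c_less[of "Suc n"] c_ge[of n] by simp
    moreover have "(2 * of_int (c n) :: real) < of_int (c (Suc n)) + 1"
      using c_less[of n] c_ge[of "Suc n"] by simp
    ultimately have "c (Suc n) = 2 * c n \<or> c (Suc n) = 2 * c n + 1"
      by linarith
    then show ?thesis
      unfolding x_def by auto
  qed
  have "c 0 = 0"
    using y unfolding c_def by (simp add: ceiling_eq_iff)
  have partial: "(\<Sum>k<n. of_bool (x k) * (1/2) ^ Suc k) = (of_int (c n) / 2 ^ n :: real)" for n
  proof (induction n)
    case 0
    then show ?case using \<open>c 0 = 0\<close> by simp
  next
    case (Suc n)
    then show ?case by (simp add: c_Suc field_simps)
  qed
  have bounds: "y - (1/2) ^ n \<le> of_int (c n) / 2 ^ n" "of_int (c n) / 2 ^ n < y" for n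
    using c_less[of n] c_ge[of n] by (auto simp: power_one_over divide_simps) (auto simp: algebra_simps)
  have "(\<lambda>n. y - (1/2) ^ n) \<longlonglongrightarrow> y - 0"
    by (intro tendsto_intros LIMSEQ_power_zero) simp
  then have "(\<lambda>n. y - (1/2) ^ n) \<longlonglongrightarrow> y"
    by simp
  then have lim: "(\<lambda>n. of_int (c n) / 2 ^ n) \<longlonglongrightarrow> y"
  proof (rule tendsto_sandwich[rotated 2])
    show "(\<lambda>_. y) \<longlonglongrightarrow> y"
      by (rule tendsto_const)
    show "\<forall>\<^sub>F n in sequentially. y - (1/2) ^ n \<le> of_int (c n) / 2 ^ n"
      using bounds(1) by (intro always_eventually allI)
    show "\<forall>\<^sub>F n in sequentially. of_int (c n) / 2 ^ n \<le> y"
      using bounds(2) by (intro always_eventually allI less_imp_le)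
  qed
  then have "(\<lambda>k. of_bool (x k) * (1/2) ^ Suc k) sums y"
    unfolding sums_def partial .
  then show "y = digit_sum (1/2) x"
    unfolding digit_sum_def by (simp add: sums_iff)
  show "x \<in> - fin_support"
  proof
    \<comment> \<open>With finite support the dyadic approximations are eventually constant, hence
      equal to their limit \<open>y\<close>, against the strict bound from below.\<close>
    assume "x \<in> fin_support"
    then obtain m where m: "\<And>i. x i \<Longrightarrow> i < m"
      unfolding fin_support_def finite_nat_set_iff_bounded by auto
    have "of_int (c (m + n)) / 2 ^ (m + n) = (of_int (c m) / 2 ^ m :: real)" for n
    proof (induction n)
      case (Suc n)
      have "\<not> x (m + n)" using m by force
      then have "c (m + Suc n) = 2 * c (m + n)"
        using c_Suc[of "m + n"] by simp
      then show ?case using Suc by simp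
    qed simp
    moreover have "(\<lambda>n. of_int (c (m + n)) / 2 ^ (m + n)) \<longlonglongrightarrow> y"
      using LIMSEQ_ignore_initial_segment[OF lim, of m] by (simp add: add.commute)
    ultimately have "y = of_int (c m) / 2 ^ m"
      by (simp add: LIMSEQ_const_iff)
    then show False
      using bounds(2)[of m] by simp
  qed
qed

lemma inj_on_binary: "inj_on (digit_sum (1/2)) (- fin_support)"
  using infinite_support by (intro inj_on_digit_sum) (auto simp: infinite_nat_iff_unbounded)

section \<open>Comparing the covering numbers\<close>

lemma Cov_Baire_le_Cantor: "Cov (Cont TYPE(nat \<Rightarrow> nat)) \<le>o Cov (Cont TYPE(nat \<Rightarrow> bool))"
proof (rule Cov_Cont_mono)
  fix S :: "((nat \<Rightarrow> bool) \<Rightarrow> nat \<Rightarrow> bool) set"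
  assume S: "graph_cover S"
  have onto: "(\<Union>n :: nat. gaps ` (- fin_support)) = UNIV"
    by (simp add: gaps_onto)
  show "\<exists>S' :: ((nat \<Rightarrow> nat) \<Rightarrow> nat \<Rightarrow> nat) set.
      graph_cover S' \<and> |S'| \<le>o |S <+> (UNIV :: nat set)|"
    by (rule graph_cover_from_Cantor[where 'b = "nat \<Rightarrow> nat" and b = "\<lambda>_. gaps",
          OF countable_fin_support continuous_on_gaps inj_on_gaps onto _ _ S])
      (rule compact_imp_closed_sequences continuous_extension_sequences; assumption)+
qed

lemma Cov_real_le_Cantor: "Cov (Cont TYPE(real)) \<le>o Cov (Cont TYPE(nat \<Rightarrow> bool))"
proof (rule Cov_Cont_mono)
  fix S :: "((nat \<Rightarrow> bool) \<Rightarrow> nat \<Rightarrow> bool) set"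
  assume S: "graph_cover S"
  \<comment> \<open>The integer translates of \<open>(0, 1]\<close> cover the line;
    \<open>int_decode\<close> enumerates the shifts.\<close>
  define b where "b n x = of_int (int_decode n) + digit_sum (1/2) x" for n x
  show "\<exists>S' :: (real \<Rightarrow> real) set. graph_cover S' \<and> |S'| \<le>o |S <+> (UNIV :: nat set)|"
  proof (rule graph_cover_from_Cantor[OF countable_fin_support _ _ _ _ _ S])
    show "continuous_on (- fin_support) (b n)" for n
      unfolding b_def[abs_def] using continuous_on_digit_sum[of "1/2"]
      by (intro continuous_intros) (auto intro: continuous_on_subset)
    show "inj_on (b n) (- fin_support)" for n
      using inj_on_binary unfolding b_def[abs_def] inj_on_def by simp
    have "y \<in> (\<Union>n. b n ` (- fin_support))" for y
    proof -
      \<comment> \<open>The ceiling minus one puts the remainder into \<open>(0, 1]\<close>, not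
        \<open>[0, 1)\<close>, matching the range of nonterminating expansions.\<close>
      define z where "z = \<lceil>y\<rceil> - 1"
      have "0 < y - of_int z" "y - of_int z \<le> 1"
        unfolding z_def by linarith+
      then obtain x where "x \<in> - fin_support" "y - of_int z = digit_sum (1/2) x"
        using binary_expansion by blast
      then have "y = b (int_encode z) x" "x \<in> - fin_support"
        unfolding b_def by simp_all
      then show ?thesis by blast
    qed
    then show "(\<Union>n. b n ` (- fin_support)) = UNIV" by blast
    show "closed K" if "compact K" for K :: "real set"
      using that by (rule compact_imp_closed)
    show "\<exists>h. continuous_on UNIV h \<and> (\<forall>x\<in>D. h x = g x)"
      if Dg: "compact D" "continuous_on D g" for D and g :: "real \<Rightarrow> real"
    proof -
      have "closedin (top_of_set UNIV) D"
        using compact_imp_closed[OF Dg(1)] by simp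
      then obtain h where "continuous_on UNIV h" "\<And>x. x \<in> D \<Longrightarrow> h x = g x"
        using Tietze_unbounded[OF Dg(2)] by metis
      then show ?thesis by blast
    qed
  qed
qed

text \<open>The Cantor space is a retract of the Baire space via \<open>r\<close> and
  \<open>e\<close>, so \<open>r \<circ> f \<circ> e\<close> transports each
  \<open>f\<close>.\<close>

lemma Cov_Cantor_le_Baire: "Cov (Cont TYPE(nat \<Rightarrow> bool)) \<le>o Cov (Cont TYPE(nat \<Rightarrow> nat))"
proof (rule Cov_Cont_mono)
  fix S :: "((nat \<Rightarrow> nat) \<Rightarrow> nat \<Rightarrow> nat) set"
  assume S: "graph_cover S"
  define e :: "(nat \<Rightarrow> bool) \<Rightarrow> nat \<Rightarrow> nat" where "e x n = of_bool (x n)" for x n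
  define r :: "(nat \<Rightarrow> nat) \<Rightarrow> nat \<Rightarrow> bool" where "r x n \<longleftrightarrow> x n \<noteq> 0" for x n
  have re: "r (e x) = x" for x
    by (auto simp: r_def e_def)
  have e: "continuous_on UNIV e"
    unfolding e_def
    by (rule continuous_on_coordinatewise_then_product, rule continuous_on_finitely_determined,
        rule_tac x = "Suc i" in exI) simp
  have r: "continuous_on UNIV r"
    unfolding r_def
    by (rule continuous_on_coordinatewise_then_product, rule continuous_on_finitely_determined,
        rule_tac x = "Suc i" in exI) simp
  have "continuous_on UNIV (r \<circ> f \<circ> e)" if "f \<in> S" for f
    using graph_coverD(1)[OF S that] e r
    by (intro continuous_on_compose) (auto intro: continuous_on_subset)
  moreover have "\<exists>g\<in>(\<lambda>f. r \<circ> f \<circ> e) ` S. g x = y \<or> g y = x" for x y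
  proof -
    obtain f where "f \<in> S" "f (e x) = e y \<or> f (e y) = e x"
      using graph_coverD(2)[OF S] by blast
    then show ?thesis
      by (intro bexI[of _ "r \<circ> f \<circ> e"]) (auto simp: re)
  qed
  ultimately have "graph_cover ((\<lambda>f. r \<circ> f \<circ> e) ` S)"
    by (intro graph_coverI) auto
  moreover have "|(\<lambda>f. r \<circ> f \<circ> e) ` S| \<le>o |S <+> (UNIV :: nat set)|"
    by (intro card_of_image_ordLeq card_of_Plus1)
  ultimately show "\<exists>S' :: ((nat \<Rightarrow> bool) \<Rightarrow> nat \<Rightarrow> bool) set.
      graph_cover S' \<and> |S'| \<le>o |S <+> (UNIV :: nat set)|"
    by blast
qed

text \<open>The connected line does not retract onto a Cantor set, so each \<open>f\<close> is
  pulled back only where it maps the embedded copy into itself; that set is compact, and the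
  resulting partial map extends.\<close>

lemma Cov_Cantor_le_real: "Cov (Cont TYPE(nat \<Rightarrow> bool)) \<le>o Cov (Cont TYPE(real))"
proof (rule Cov_Cont_mono)
  fix S :: "(real \<Rightarrow> real) set"
  assume S: "graph_cover S"
  \<comment> \<open>A ratio below \<open>1/2\<close> makes expansions unique for all sequences,
    including those of finite support.\<close>
  define e where "e = digit_sum (1/3)"
  have e: "continuous_on UNIV e" and inj: "inj e"
    unfolding e_def by (auto intro!: continuous_on_digit_sum inj_on_digit_sum)
  have "compact (range e)"
    using e compact_UNIV_Cantor by (rule compact_continuous_image)
  then have closed: "closed (range e)"
    by (rule compact_imp_closed)
  have inv: "continuous_on (range e) (inv e)"
    using e compact_UNIV_Cantor inj by (intro continuous_on_inv) auto
  have "\<exists>h. continuous_on UNIV h \<and> (\<forall>x. f (e x) \<in> range e \<longrightarrow> h x = inv e (f (e x)))"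
    if "f \<in> S" for f
  proof -
    let ?D = "(f \<circ> e) -` range e"
    have fe: "continuous_on UNIV (f \<circ> e)"
      using e graph_coverD(1)[OF S that]
      by (intro continuous_on_compose) (auto intro: continuous_on_subset)
    have D: "compact ?D"
      using closed fe by (intro compact_closed_Cantor closed_vimage)
    have "continuous_on ?D (inv e \<circ> (f \<circ> e))"
      by (rule continuous_on_compose[OF continuous_on_subset[OF fe] continuous_on_subset[OF inv]]) auto
    then show ?thesis
      using continuous_extension_sequences[OF D] by fastforce
  qed
  then obtain h where h: "\<And>f. f \<in> S \<Longrightarrow> continuous_on UNIV (h f)"
    "\<And>f x. f \<in> S \<Longrightarrow> f (e x) \<in> range e \<Longrightarrow> h f x = inv e (f (e x))"
    by metis
  have "\<exists>g\<in>h ` S. g x = y \<or> g y = x" for x y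
    using graph_coverD(2)[OF S, of "e x" "e y"] h(2) inj by (metis imageI inv_f_f rangeI)
  then have "graph_cover (h ` S)"
    using h(1) by (intro graph_coverI) auto
  moreover have "|h ` S| \<le>o |S <+> (UNIV :: nat set)|"
    by (intro card_of_image_ordLeq card_of_Plus1)
  ultimately show "\<exists>S' :: ((nat \<Rightarrow> bool) \<Rightarrow> nat \<Rightarrow> bool) set.
      graph_cover S' \<and> |S'| \<le>o |S <+> (UNIV :: nat set)|"
    by blast
qed

theorem mainTheorem6:
  shows "Cov (Cont TYPE(nat \<Rightarrow> nat)) =o Cov (Cont TYPE(real)) \<and>
         Cov (Cont TYPE(real)) =o Cov (Cont TYPE(nat \<Rightarrow> bool))"
  using Cov_Baire_le_Cantor Cov_Cantor_le_Baire Cov_real_le_Cantor Cov_Cantor_le_real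
  by (meson ordIso_iff_ordLeq ordLeq_transitive)

end
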